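(* Let $\Sigma$ be a system as in the context and let $R\in\mathbb R^{r\times n}$ with $\mathrm{rank}(R)=n_{\mathrm{ext}}$ be such that $A\ker(R)\subseteq\ker(R)\subseteq\ker(C)$ (so that $\ker([R\ \ -R])$ is a total equivalence relation on $\mathbb R^n$). Let $\mathbb T=[\mathbb T^1\ \ \mathbb T^2]\in\mathbb R^{n\times n}$ be any invertible matrix with $\mathbb T^1\in\mathbb R^{n\times n_{\mathrm{ext}}}$ and $\mathrm{im}(\mathbb T^2)=\ker(R)$. Let $A^{11}$ be the upper-left $n_{\mathrm{ext}}\times n_{\mathrm{ext}}$ block of $\mathbb T^{-1}A\mathbb T$, $B^1$ and $G^1$ the first $n_{\mathrm{ext}}$ rows of $\mathbb T^{-1}B$ and $\mathbb T^{-1}G$, and $C^1=C\mathbb T^1$. Let $\Sigma_{/\mathcal R_{\mathrm{ext}}}$ be the system $x(t+1)=A^{11}x(t)+B^1u(t)+G^1w(t)$, $y(t)=C^1x(t)+\nu(t)$, $x\in\mathbb R^{n_{\mathrm{ext}}}$, with $w(t)\sim\mathcal N(\mu,I_l)$ and $\nu(t)\sim\mathcal N(0,\Psi)$ as for $\Sigma$. Then $\Sigma_{/\mathcal R_{\mathrm{ext}}}\cong_{\mathrm{ext}}\Sigma$.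
   Context: $\Sigma$: $x(t+1)=Ax(t)+Bu(t)+Gw(t)$, $y(t)=Cx(t)+\nu(t)$, $t\in\mathbb N$, $x\in\mathbb R^n$, $u\in\mathbb R^m$, $w\in\mathbb R^l$, $y,\nu\in\mathbb R^p$, where $(w(t))_t$ is i.i.d. $\mathcal N(\mu,I_l)$, $(\nu(t))_t$ is i.i.d. $\mathcal N(0,\Psi)$, mutually independent. For any such system $\Sigma_i$ (matrices $A_i,B_i,C_i,G_i$, state dimension $n_i$) with deterministic initial state $x_i^0$ and deterministic input $\mathbf u:\mathbb N\to\mathbb R^m$, $\mathbf x_i|_{x_i^0,\mathbf u}(t)=A_i^tx_i^0+\sum_{\tau=0}^{t-1}A_i^{t-1-\tau}(B_iu(\tau)+G_iw_i(\tau))$ and $\mathbf y_i|_{x_i^0,\mathbf u}(t)=C_i\mathbf x_i|_{x_i^0,\mathbf u}(t)+\nu_i(t)$. Processes are stochastically equivalent ($\sim$) if all finite-dimensional joint distributions coincide. A relation $\mathcal R\subseteq\mathbb R^{n_1}\times\mathbb R^{n_2}$ is total if every $x_1$ is related to some $x_2$ and every $x_2$ to some $x_1$. $\Sigma_1\cong_{\mathrm{ext}}\Sigma_2$ means there is a total subspace $\mathcal R\subseteq\mathbb R^{n_1}\times\mathbb R^{n_2}$ such that $\mathbf y_1|_{x_1^0,\mathbf u}\sim\mathbf y_2|_{x_2^0,\mathbf u}$ for all $(x_1^0,x_2^0)\in\mathcal R$ and all inputs $\mathbf u$. *)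

theory Defs
  imports "Jordan_Normal_Form.Matrix_Kernel" "Jordan_Normal_Form.DL_Rank" "HOL-Probability.Probability"
begin

fun lti_state :: "real mat \<Rightarrow> real mat \<Rightarrow> real mat \<Rightarrow> real Matrix.vec \<Rightarrow> (nat \<Rightarrow> real Matrix.vec)
    \<Rightarrow> (nat \<Rightarrow> 'a \<Rightarrow> real Matrix.vec) \<Rightarrow> nat \<Rightarrow> 'a \<Rightarrow> real Matrix.vec" where
  "lti_state A B G x0 u w 0 \<omega> = x0"
| "lti_state A B G x0 u w (Suc t) \<omega> = A *\<^sub>v lti_state A B G x0 u w t \<omega> + B *\<^sub>v u t + G *\<^sub>v w t \<omega>"

definition lti_output :: "real mat \<Rightarrow> real mat \<Rightarrow> real mat \<Rightarrow> real mat \<Rightarrow> real Matrix.vec \<Rightarrow> (nat \<Rightarrow> real Matrix.vec)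
    \<Rightarrow> (nat \<Rightarrow> 'a \<Rightarrow> real Matrix.vec) \<Rightarrow> (nat \<Rightarrow> 'a \<Rightarrow> real Matrix.vec) \<Rightarrow> nat \<Rightarrow> 'a \<Rightarrow> real Matrix.vec" where
  "lti_output C A B G x0 u w \<nu> t \<omega> = C *\<^sub>v lti_state A B G x0 u w t \<omega> + \<nu> t \<omega>"

definition gauss_measure :: "real \<Rightarrow> real \<Rightarrow> real measure" where
  "gauss_measure m v = (if v = 0 then return borel m else density lborel (normal_density m (sqrt v)))"

definition gaussian_vec :: "'a measure \<Rightarrow> nat \<Rightarrow> ('a \<Rightarrow> real Matrix.vec) \<Rightarrow> real Matrix.vec \<Rightarrow> real mat \<Rightarrow> bool" where
  "gaussian_vec M d X m S \<longleftrightarrow>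
     (\<forall>a\<in>carrier_vec d. distr M borel (\<lambda>\<omega>. scalar_prod a (X \<omega>)) = gauss_measure (scalar_prod a m) (scalar_prod a (S *\<^sub>v a)))"

definition vec_coords :: "nat \<Rightarrow> real Matrix.vec \<Rightarrow> nat \<Rightarrow> real" where
  "vec_coords d v = (\<lambda>i\<in>{..<d}. vec_index v i)"

definition noise_model :: "'a measure \<Rightarrow> nat \<Rightarrow> nat \<Rightarrow> real Matrix.vec \<Rightarrow> real mat
    \<Rightarrow> (nat \<Rightarrow> 'a \<Rightarrow> real Matrix.vec) \<Rightarrow> (nat \<Rightarrow> 'a \<Rightarrow> real Matrix.vec) \<Rightarrow> bool" where
  "noise_model M l p \<mu> \<Psi> w \<nu> \<longleftrightarrow>
     prob_space M \<and>
     (\<forall>t. \<forall>\<omega>\<in>space M. w t \<omega> \<in> carrier_vec l \<and> \<nu> t \<omega> \<in> carrier_vec p) \<and>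
     prob_space.indep_vars M
       (\<lambda>k. case k of Inl _ \<Rightarrow> PiM {..<l} (\<lambda>_. borel) | Inr _ \<Rightarrow> PiM {..<p} (\<lambda>_. borel))
       (\<lambda>k \<omega>. case k of Inl t \<Rightarrow> vec_coords l (w t \<omega>) | Inr t \<Rightarrow> vec_coords p (\<nu> t \<omega>))
       (UNIV :: (nat + nat) set) \<and>
     (\<forall>t. gaussian_vec M l (w t) \<mu> (1\<^sub>m l)) \<and>
     (\<forall>t. gaussian_vec M p (\<nu> t) (0\<^sub>v p) \<Psi>)"

definition stoch_equiv :: "nat \<Rightarrow> 'a measure \<Rightarrow> (nat \<Rightarrow> 'a \<Rightarrow> real Matrix.vec)
    \<Rightarrow> 'b measure \<Rightarrow> (nat \<Rightarrow> 'b \<Rightarrow> real Matrix.vec) \<Rightarrow> bool" where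
  "stoch_equiv p M1 Y1 M2 Y2 \<longleftrightarrow>
     (\<forall>S. finite S \<longrightarrow>
        distr M1 (PiM S (\<lambda>_. PiM {..<p} (\<lambda>_. borel))) (\<lambda>\<omega>. \<lambda>t\<in>S. vec_coords p (Y1 t \<omega>))
      = distr M2 (PiM S (\<lambda>_. PiM {..<p} (\<lambda>_. borel))) (\<lambda>\<omega>. \<lambda>t\<in>S. vec_coords p (Y2 t \<omega>)))"

definition total_subspace :: "nat \<Rightarrow> nat \<Rightarrow> (real Matrix.vec \<times> real Matrix.vec) set \<Rightarrow> bool" where
  "total_subspace n1 n2 Rel \<longleftrightarrow>
     Rel \<subseteq> carrier_vec n1 \<times> carrier_vec n2 \<and>
     (0\<^sub>v n1, 0\<^sub>v n2) \<in> Rel \<and>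
     (\<forall>(a, b)\<in>Rel. \<forall>(c, d)\<in>Rel. (a + c, b + d) \<in> Rel) \<and>
     (\<forall>k. \<forall>(a, b)\<in>Rel. (k \<cdot>\<^sub>v a, k \<cdot>\<^sub>v b) \<in> Rel) \<and>
     (\<forall>x\<in>carrier_vec n1. \<exists>y. (x, y) \<in> Rel) \<and>
     (\<forall>y\<in>carrier_vec n2. \<exists>x. (x, y) \<in> Rel)"

text \<open>Sigma_1 =~ext Sigma_2, each system given with its own noise realisation (M_i, w_i, nu_i);
  m = input dimension, p = output dimension.\<close>
definition ext_equiv ::
  "nat \<Rightarrow> nat \<Rightarrow>
   nat \<Rightarrow> real mat \<Rightarrow> real mat \<Rightarrow> real mat \<Rightarrow> real mat \<Rightarrow> 'a measure \<Rightarrow> (nat \<Rightarrow> 'a \<Rightarrow> real Matrix.vec) \<Rightarrow> (nat \<Rightarrow> 'a \<Rightarrow> real Matrix.vec) \<Rightarrow>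
   nat \<Rightarrow> real mat \<Rightarrow> real mat \<Rightarrow> real mat \<Rightarrow> real mat \<Rightarrow> 'b measure \<Rightarrow> (nat \<Rightarrow> 'b \<Rightarrow> real Matrix.vec) \<Rightarrow> (nat \<Rightarrow> 'b \<Rightarrow> real Matrix.vec) \<Rightarrow> bool" where
  "ext_equiv m p n1 A1 B1 G1 C1 M1 w1 \<nu>1 n2 A2 B2 G2 C2 M2 w2 \<nu>2 \<longleftrightarrow>
     (\<exists>Rel. total_subspace n1 n2 Rel \<and>
        (\<forall>(x1, x2)\<in>Rel. \<forall>u. (\<forall>t. u t \<in> carrier_vec m) \<longrightarrow>
           stoch_equiv p M1 (lti_output C1 A1 B1 G1 x1 u w1 \<nu>1) M2 (lti_output C2 A2 B2 G2 x2 u w2 \<nu>2)))"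

end

theory Submission
  imports Defs
begin

text \<open>
  The map sending \<open>x\<close> to the first \<open>ne\<close> coordinates of \<open>T\<^sup>-\<^sup>1 x\<close> annihilates \<open>ker R\<close>. As
  \<open>ker R\<close> is \<open>A\<close>-invariant and contained in \<open>ker C\<close>, this map carries the dynamics of the system to
  those of the quotient and preserves the output, so its graph is a total subspace on which both
  systems produce the same output path whenever they are driven by the same noise path.

  The two systems live on different probability spaces, so the laws of their noise paths must be
  compared. By independence it suffices to compare single noise vectors, about which only the laws
  of all scalar projections are known; that these determine the joint law is the Cramer-Wold
  theorem. It is reduced to the one-dimensional uniqueness theorem for characteristic functions by
  replacing, one coordinate at a time, the factor \<open>exp (i t\<^sub>k X\<^sub>k)\<close> in the joint characteristic
  function by the indicator of an arbitrary Borel set in \<open>X\<^sub>k\<close>.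
\<close>

subsection \<open>The Cramer-Wold theorem\<close>

text \<open>
  Shifting the bounded weight \<open>h\<close> by \<open>2\<close> makes it a positive density, so that the uniqueness
  theorem, which is stated for probability measures only, applies to signed weights.
\<close>

lemma (in prob_space) tilted_law:
  fixes X h :: "'a \<Rightarrow> real"
  assumes [measurable]: "X \<in> borel_measurable M" "h \<in> borel_measurable M"
    and h: "\<And>x. \<bar>h x\<bar> \<le> 1"
  defines "c \<equiv> 2 + expectation h"
  defines "D \<equiv> distr (density M (\<lambda>x. ennreal ((2 + h x) / c))) borel X"
  shows tilted_law_pos: "c > 0"
    and tilted_law_distribution: "real_distribution D"
    and tilted_law_char: "char D t =
      (2 * char (distr M borel X) t + (CLINT x|M. of_real (h x) * iexp (t * X x))) / of_real c"
    and tilted_law_measure: "A \<in> sets borel \<Longrightarrow> measure D A =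
      (2 * measure (distr M borel X) A + (\<integral>x. h x * indicator A (X x) \<partial>M)) / c"
proof -
  have int_h: "integrable M h"
    by (rule integrable_const_bound[where B=1]) (use h in auto)
  have "expectation h \<ge> expectation (\<lambda>_. -1)"
    by (rule integral_mono[OF _ int_h]) (use h in \<open>auto simp: abs_le_iff minus_le_iff\<close>)
  then show c: "c > 0"
    by (simp add: c_def prob_space)
  have nonneg: "0 \<le> (2 + h x) / c" for x
    using h[of x] c by (auto simp: abs_le_iff)
  let ?N = "density M (\<lambda>x. ennreal ((2 + h x) / c))"
  \<comment> \<open>\<open>c\<close> is the integral of \<open>2 + h\<close>, so dividing by it
    gives total mass 1.\<close>
  have "emeasure ?N (space ?N) = (\<integral>\<^sup>+x. ennreal ((2 + h x) / c) \<partial>M)"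
    by (subst emeasure_density) (auto intro!: nn_integral_cong)
  also have "\<dots> = ennreal (\<integral>x. (2 + h x) / c \<partial>M)"
    using int_h nonneg by (intro nn_integral_eq_integral) auto
  also have "(\<integral>x. (2 + h x) / c \<partial>M) = 1"
    using c int_h by (simp add: c_def prob_space)
  finally interpret N: prob_space ?N
    by (intro prob_spaceI) simp
  show "real_distribution D"
    unfolding D_def by (rule N.real_distribution_distr) simp
  have int_e: "integrable M (\<lambda>x. iexp (t * X x))"
    by (rule integrable_const_bound[where B=1]) auto
  have int_he: "integrable M (\<lambda>x. of_real (h x) * iexp (t * X x))"
    by (rule integrable_const_bound[where B=1]) (use h in \<open>auto simp: norm_mult\<close>)
  have "char D t = (CLINT x|M. ((2 + h x) / c) *\<^sub>R iexp (t * X x))"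
    unfolding D_def char_def using nonneg
    by (subst integral_distr) (auto simp: integral_density)
  also have "\<dots> = (CLINT x|M. (2 * iexp (t * X x) + of_real (h x) * iexp (t * X x)) / of_real c)"
    by (intro Bochner_Integration.integral_cong) (auto simp: scaleR_conv_of_real field_simps)
  also have "\<dots> = (2 * char (distr M borel X) t + (CLINT x|M. of_real (h x) * iexp (t * X x))) / of_real c"
    using int_e int_he by (simp add: char_def integral_distr)
  finally show "char D t =
      (2 * char (distr M borel X) t + (CLINT x|M. of_real (h x) * iexp (t * X x))) / of_real c" .
  assume A[measurable]: "A \<in> sets borel"
  have int_i: "integrable M (\<lambda>x. indicator A (X x) :: real)"
    by (rule integrable_const_bound[where B=1]) auto
  have int_hi: "integrable M (\<lambda>x. h x * indicator A (X x))"
    by (rule integrable_const_bound[where B=1]) (use h in \<open>auto simp: indicator_def\<close>)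
  interpret D: real_distribution D by fact
  have "measure D A = (\<integral>y. indicator A y \<partial>D)"
    by simp
  also have "\<dots> = (\<integral>x. ((2 + h x) / c) *\<^sub>R indicator A (X x) \<partial>M)"
    unfolding D_def using nonneg
    by (subst integral_distr) (auto simp: integral_density)
  also have "\<dots> = (\<integral>x. (2 * indicator A (X x) + h x * indicator A (X x)) / c \<partial>M)"
    by (intro Bochner_Integration.integral_cong) (auto simp: field_simps)
  also have "\<dots> = (2 * (\<integral>x. indicator A (X x) \<partial>M) + (\<integral>x. h x * indicator A (X x) \<partial>M)) / c"
    using int_i int_hi by simp
  also have "(\<integral>x. indicator A (X x) \<partial>M) = (\<integral>y. (indicator A y :: real) \<partial>distr M borel X)"
    by (subst integral_distr) auto
  also have "\<dots> = measure (distr M borel X) A"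
    by simp
  finally show "measure D A =
      (2 * measure (distr M borel X) A + (\<integral>x. h x * indicator A (X x) \<partial>M)) / c" .
qed

text \<open>The laws tilted by \<open>2 + h\<close> and \<open>2 + k\<close> have the same
  characteristic function, hence agree by Levy uniqueness, and so do the untilted laws. In the
  formula for the tilted measure of \<open>A\<close> everything but the weighted integral is then
  known to agree, so that integral can be solved for.\<close>

lemma weighted_law_eqI:
  fixes X h :: "'a \<Rightarrow> real" and Y k :: "'b \<Rightarrow> real"
  assumes "prob_space M" "prob_space N"
    and m: "X \<in> borel_measurable M" "h \<in> borel_measurable M"
      "Y \<in> borel_measurable N" "k \<in> borel_measurable N"
    and b: "\<And>x. \<bar>h x\<bar> \<le> 1" "\<And>x. \<bar>k x\<bar> \<le> 1"
    and XY: "\<And>t. char (distr M borel X) t = char (distr N borel Y) t"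
    and hk: "\<And>t. (CLINT x|M. of_real (h x) * iexp (t * X x)) = (CLINT x|N. of_real (k x) * iexp (t * Y x))"
    and A: "A \<in> sets borel"
  shows "(\<integral>x. h x * indicator A (X x) \<partial>M) = (\<integral>x. k x * indicator A (Y x) \<partial>N)"
proof -
  interpret M: prob_space M by fact
  interpret N: prob_space N by fact
  \<comment> \<open>Frequency 0 in \<open>hk\<close> equates the two expectations, hence the two
    normalising constants.\<close>
  have E: "M.expectation h = N.expectation k"
    using hk[of 0] by simp
  note tM = M.tilted_law[OF m(1,2) b(1)] and tN = N.tilted_law[OF m(3,4) b(2)]
  have D: "distr (density M (\<lambda>x. ennreal ((2 + h x) / (2 + M.expectation h)))) borel X
      = distr (density N (\<lambda>x. ennreal ((2 + k x) / (2 + N.expectation k)))) borel Y"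
    by (intro Levy_uniqueness tM(2) tN(2) ext) (subst tM(3), subst tN(3), simp only: XY hk E)
  have "distr M borel X = distr N borel Y"
    using m XY by (intro Levy_uniqueness M.real_distribution_distr N.real_distribution_distr ext)
  with tM(4)[OF A] tN(4)[OF A] D tM(1) show ?thesis
    by (simp add: E)
qed

text \<open>Weighted laws are compared for real weights only, whereas the phase
  \<open>iexp (\<theta> x)\<close> is complex. Euler's formulas express the cosine and sine weights
  through exponentials with phases \<theta> and -\<theta>, and the last claim reassembles the phase
  from them. The factors \<open>1\<close> and \<open>-1\<close> stay explicit to match the pattern
  \<open>e * \<theta> x\<close>.\<close>

lemma (in prob_space) expectation_iexp_shift:
  fixes X P \<theta> :: "'a \<Rightarrow> real"
  assumes [measurable]: "X \<in> borel_measurable M" "P \<in> borel_measurable M" "\<theta> \<in> borel_measurable M"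
    and P: "\<And>x. \<bar>P x\<bar> \<le> 1"
  shows expectation_cos_iexp: "(CLINT x|M. of_real (P x * cos (\<theta> x)) * iexp (s * X x)) =
      ((CLINT x|M. of_real (P x) * iexp (s * X x + 1 * \<theta> x)) + (CLINT x|M. of_real (P x) * iexp (s * X x + (-1) * \<theta> x))) / 2"
    and expectation_sin_iexp: "(CLINT x|M. of_real (P x * sin (\<theta> x)) * iexp (s * X x)) =
      \<i> * ((CLINT x|M. of_real (P x) * iexp (s * X x + (-1) * \<theta> x)) - (CLINT x|M. of_real (P x) * iexp (s * X x + 1 * \<theta> x))) / 2"
    and expectation_indicator_iexp: "A \<in> sets borel \<Longrightarrow>
      (CLINT x|M. of_real (indicator A (X x) * P x) * iexp (\<theta> x)) =
      of_real (\<integral>x. (P x * cos (\<theta> x)) * indicator A (X x) \<partial>M) + \<i> * of_real (\<integral>x. (P x * sin (\<theta> x)) * indicator A (X x) \<partial>M)"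
proof -
  have int: "integrable M (\<lambda>x. of_real (P x) * iexp (s * X x + e * \<theta> x))" for e
    by (rule integrable_const_bound[where B=1]) (use P in \<open>auto simp: norm_mult simp del: of_real_add of_real_mult\<close>)
  have cis_c: "of_real (P x * cos (\<theta> x)) * iexp (s * X x) =
      (of_real (P x) * iexp (s * X x + 1 * \<theta> x) + of_real (P x) * iexp (s * X x + (-1) * \<theta> x)) / 2" for x
    unfolding cis_conv_exp[symmetric] by (simp add: complex_eq_iff cos_add sin_add cos_diff sin_diff field_simps)
  have cis_s: "of_real (P x * sin (\<theta> x)) * iexp (s * X x) =
      \<i> * (of_real (P x) * iexp (s * X x + (-1) * \<theta> x) - of_real (P x) * iexp (s * X x + 1 * \<theta> x)) / 2" for x
    unfolding cis_conv_exp[symmetric] by (simp add: complex_eq_iff cos_add sin_add cos_diff sin_diff field_simps)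
  show "(CLINT x|M. of_real (P x * cos (\<theta> x)) * iexp (s * X x)) =
      ((CLINT x|M. of_real (P x) * iexp (s * X x + 1 * \<theta> x)) + (CLINT x|M. of_real (P x) * iexp (s * X x + (-1) * \<theta> x))) / 2"
    unfolding cis_c using int[of 1] int[of "-1"] by (simp del: of_real_add of_real_mult mult_minus1 mult_1 of_real_diff)
  show "(CLINT x|M. of_real (P x * sin (\<theta> x)) * iexp (s * X x)) =
      \<i> * ((CLINT x|M. of_real (P x) * iexp (s * X x + (-1) * \<theta> x)) - (CLINT x|M. of_real (P x) * iexp (s * X x + 1 * \<theta> x))) / 2"
    unfolding cis_s using int[of 1] int[of "-1"] by (simp del: of_real_add of_real_mult mult_minus1 mult_1 of_real_diff)
  assume A[measurable]: "A \<in> sets borel"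
  have bnd: "\<bar>P x\<bar> * \<bar>cos (\<theta> x)\<bar> \<le> 1" "\<bar>P x\<bar> * \<bar>sin (\<theta> x)\<bar> \<le> 1" for x
    using P[of x] by (auto intro!: mult_le_one)
  have int_c: "integrable M (\<lambda>x. (P x * cos (\<theta> x)) * indicator A (X x))"
    by (rule integrable_const_bound[where B=1]) (use bnd in \<open>auto simp: indicator_def abs_mult\<close>)
  have int_s: "integrable M (\<lambda>x. (P x * sin (\<theta> x)) * indicator A (X x))"
    by (rule integrable_const_bound[where B=1]) (use bnd in \<open>auto simp: indicator_def abs_mult\<close>)
  have "(CLINT x|M. of_real (indicator A (X x) * P x) * iexp (\<theta> x)) =
      (CLINT x|M. of_real ((P x * cos (\<theta> x)) * indicator A (X x)) + \<i> * of_real ((P x * sin (\<theta> x)) * indicator A (X x)))"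
    by (intro Bochner_Integration.integral_cong)
      (simp_all add: cis_conv_exp[symmetric] complex_eq_iff)
  also have "\<dots> = (CLINT x|M. of_real ((P x * cos (\<theta> x)) * indicator A (X x)))
      + \<i> * (CLINT x|M. of_real ((P x * sin (\<theta> x)) * indicator A (X x)))"
    using int_c int_s
    by (subst Bochner_Integration.integral_add)
      (simp_all only: complex_of_real_integrable_eq integrable_mult_right integral_mult_right_zero)
  finally show "(CLINT x|M. of_real (indicator A (X x) * P x) * iexp (\<theta> x)) =
      of_real (\<integral>x. (P x * cos (\<theta> x)) * indicator A (X x) \<partial>M) + \<i> * of_real (\<integral>x. (P x * sin (\<theta> x)) * indicator A (X x) \<partial>M)"
    unfolding integral_complex_of_real .
qed

text \<open>A single exchange: the character in \<open>X\<close>, known at all frequencies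
  \<open>s\<close>, is traded for an indicator while the phase \<theta> of the other coordinates
  stays. The scaling \<open>e\<close> supplies the phases \<theta> and -\<theta> from which cosine
  and sine are built.\<close>

lemma expectation_indicator_iexp_eqI:
  fixes X P \<theta> :: "'a \<Rightarrow> real" and Y Q \<phi> :: "'b \<Rightarrow> real"
  assumes M: "prob_space M" and N: "prob_space N"
    and mX: "X \<in> borel_measurable M" "P \<in> borel_measurable M" "\<theta> \<in> borel_measurable M"
    and mY: "Y \<in> borel_measurable N" "Q \<in> borel_measurable N" "\<phi> \<in> borel_measurable N"
    and P: "\<And>x. \<bar>P x\<bar> \<le> 1" and Q: "\<And>x. \<bar>Q x\<bar> \<le> 1"
    and XY: "\<And>t. char (distr M borel X) t = char (distr N borel Y) t"
    and eq: "\<And>s e. (CLINT x|M. of_real (P x) * iexp (s * X x + e * \<theta> x)) = (CLINT x|N. of_real (Q x) * iexp (s * Y x + e * \<phi> x))"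
    and A: "A \<in> sets borel"
  shows "(CLINT x|M. of_real (indicator A (X x) * P x) * iexp (\<theta> x)) = (CLINT x|N. of_real (indicator A (Y x) * Q x) * iexp (\<phi> x))"
proof -
  note [measurable] = mX mY
  have b: "\<bar>P x * cos (\<theta> x)\<bar> \<le> 1" "\<bar>P x * sin (\<theta> x)\<bar> \<le> 1" for x
    using P[of x] by (auto simp: abs_mult intro!: mult_le_one)
  have b': "\<bar>Q x * cos (\<phi> x)\<bar> \<le> 1" "\<bar>Q x * sin (\<phi> x)\<bar> \<le> 1" for x
    using Q[of x] by (auto simp: abs_mult intro!: mult_le_one)
  note eM = prob_space.expectation_iexp_shift[OF M mX P]
  note eN = prob_space.expectation_iexp_shift[OF N mY Q]
  \<comment> \<open>The real and imaginary parts of the phase are treated as two separate real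
    weights, each bounded by 1.\<close>
  have c: "(\<integral>x. (P x * cos (\<theta> x)) * indicator A (X x) \<partial>M) = (\<integral>x. (Q x * cos (\<phi> x)) * indicator A (Y x) \<partial>N)"
    by (rule weighted_law_eqI[OF M N _ _ _ _ b(1) b'(1) XY _ A]) (simp_all only: eM(1) eN(1) eq, measurable)
  have s: "(\<integral>x. (P x * sin (\<theta> x)) * indicator A (X x) \<partial>M) = (\<integral>x. (Q x * sin (\<phi> x)) * indicator A (Y x) \<partial>N)"
    by (rule weighted_law_eqI[OF M N _ _ _ _ b(2) b'(2) XY _ A]) (simp_all only: eM(2) eN(2) eq, measurable)
  show ?thesis
    unfolding eM(3)[OF A] eN(3)[OF A] c s ..
qed

text \<open>Exchanging the characters one coordinate at a time ends with the probabilities of boxes,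
  and these determine a probability law on a finite product.\<close>

lemma distr_PiM_eqI_char:
  fixes X :: "'i \<Rightarrow> 'a \<Rightarrow> real" and Y :: "'i \<Rightarrow> 'b \<Rightarrow> real"
  assumes M: "prob_space M" and N: "prob_space N" and I: "finite I"
    and X: "\<And>i. i \<in> I \<Longrightarrow> X i \<in> borel_measurable M"
    and Y: "\<And>i. i \<in> I \<Longrightarrow> Y i \<in> borel_measurable N"
    and char: "\<And>t. (CLINT x|M. iexp (\<Sum>i\<in>I. t i * X i x)) = (CLINT x|N. iexp (\<Sum>i\<in>I. t i * Y i x))"
  shows "distr M (PiM I (\<lambda>_. borel)) (\<lambda>x. \<lambda>i\<in>I. X i x) = distr N (PiM I (\<lambda>_. borel)) (\<lambda>x. \<lambda>i\<in>I. Y i x)"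
proof -
  interpret M: prob_space M by fact
  interpret N: prob_space N by fact
  \<comment> \<open>Coordinates in \<open>K\<close> carry indicators, the others keep their
    characters: \<open>K\<close> empty is the hypothesis, \<open>K = I\<close> gives the boxes. The
    frequencies \<open>t\<close> stay arbitrary because the induction step uses the induction
    hypothesis at modified ones.\<close>
  have mixed: "(CLINT x|M. of_real (\<Prod>i\<in>K. indicator (A i) (X i x)) * iexp (\<Sum>i\<in>I - K. t i * X i x))
      = (CLINT x|N. of_real (\<Prod>i\<in>K. indicator (A i) (Y i x)) * iexp (\<Sum>i\<in>I - K. t i * Y i x))"
    if "finite K" "K \<subseteq> I" "\<And>i. i \<in> K \<Longrightarrow> A i \<in> sets borel" for K t and A :: "'i \<Rightarrow> real set"
    using that
  proof (induction K arbitrary: t rule: finite_induct)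
    case empty
    then show ?case using char by simp
  next
    case (insert k K)
    let ?J = "I - insert k K"
    have k: "k \<in> I" "finite ?J" "k \<notin> ?J" "I - K = insert k ?J"
      using insert.prems insert.hyps I by auto
    have IH: "(CLINT x|M. of_real (\<Prod>i\<in>K. indicator (A i) (X i x)) * iexp (\<Sum>i\<in>I - K. t i * X i x))
        = (CLINT x|N. of_real (\<Prod>i\<in>K. indicator (A i) (Y i x)) * iexp (\<Sum>i\<in>I - K. t i * Y i x))" for t
      by (rule insert.IH) (use insert.prems in auto)
    \<comment> \<open>Frequency \<open>s\<close> at \<open>k\<close> and \<open>e * t i\<close>
      elsewhere separates the character of coordinate \<open>k\<close> from the remaining phase
      scaled by \<open>e\<close>.\<close>
    have split: "(\<Sum>i\<in>I - K. (if i = k then s else e * t i) * z i) = s * z k + e * (\<Sum>i\<in>?J. t i * z i)"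
      for s e and z :: "'i \<Rightarrow> real"
      unfolding k(4) sum.insert[OF k(2,3)] sum_distrib_left
      by (intro arg_cong2[where f="(+)"] sum.cong) auto
    \<comment> \<open>A frequency vector supported on \<open>k\<close> recovers the characteristic
      function of the single coordinate \<open>k\<close> from the joint one.\<close>
    have split1: "(\<Sum>i\<in>I. (if i = k then s else 0) * z i) = s * z k" for s and z :: "'i \<Rightarrow> real"
      using I k(1) by (simp add: if_distrib[of "\<lambda>a. a * _"] cong: if_cong)
    have bound: "\<bar>\<Prod>i\<in>K. indicator (A i) (z i) :: real\<bar> \<le> 1" for z
      unfolding abs_prod by (intro prod_le_1) auto
    have "(CLINT x|M. of_real (indicator (A k) (X k x) * (\<Prod>i\<in>K. indicator (A i) (X i x))) * iexp (\<Sum>i\<in>?J. t i * X i x))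
      = (CLINT x|N. of_real (indicator (A k) (Y k x) * (\<Prod>i\<in>K. indicator (A i) (Y i x))) * iexp (\<Sum>i\<in>?J. t i * Y i x))"
    proof (rule expectation_indicator_iexp_eqI[OF M N, where X = "X k" and Y = "Y k" and A = "A k"
          and P = "\<lambda>x. \<Prod>i\<in>K. indicator (A i) (X i x)" and Q = "\<lambda>x. \<Prod>i\<in>K. indicator (A i) (Y i x)"
          and \<theta> = "\<lambda>x. \<Sum>i\<in>?J. t i * X i x" and \<phi> = "\<lambda>x. \<Sum>i\<in>?J. t i * Y i x"])
      show "X k \<in> borel_measurable M" "Y k \<in> borel_measurable N"
        using k(1) X Y by auto
      show "(\<lambda>x. \<Sum>i\<in>?J. t i * X i x) \<in> borel_measurable M"
        "(\<lambda>x. \<Sum>i\<in>?J. t i * Y i x) \<in> borel_measurable N"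
        using X Y by (auto intro!: borel_measurable_sum borel_measurable_times)
      show "(\<lambda>x. \<Prod>i\<in>K. indicator (A i) (X i x) :: real) \<in> borel_measurable M"
        "(\<lambda>x. \<Prod>i\<in>K. indicator (A i) (Y i x) :: real) \<in> borel_measurable N"
        using X Y insert.prems
        by (auto intro!: borel_measurable_prod measurable_compose[OF _ borel_measurable_indicator])
      show "A k \<in> sets borel"
        using insert.prems by auto
      show "char (distr M borel (X k)) s = char (distr N borel (Y k)) s" for s
        using char[of "\<lambda>i. if i = k then s else 0"] X[OF k(1)] Y[OF k(1)]
        unfolding split1 by (simp add: char_def integral_distr)
      show "(CLINT x|M. of_real (\<Prod>i\<in>K. indicator (A i) (X i x)) * iexp (s * X k x + e * (\<Sum>i\<in>?J. t i * X i x)))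
        = (CLINT x|N. of_real (\<Prod>i\<in>K. indicator (A i) (Y i x)) * iexp (s * Y k x + e * (\<Sum>i\<in>?J. t i * Y i x)))" for s e
        using IH[of "\<lambda>i. if i = k then s else e * t i"] unfolding split .
    next
      show "\<bar>\<Prod>i\<in>K. indicator (A i) (X i x) :: real\<bar> \<le> 1" for x by (rule bound)
    next
      show "\<bar>\<Prod>i\<in>K. indicator (A i) (Y i x) :: real\<bar> \<le> 1" for x by (rule bound)
    qed
    then show ?case
      using insert.hyps by simp
  qed
  have mX: "(\<lambda>x. \<lambda>i\<in>I. X i x) \<in> measurable M (PiM I (\<lambda>_. borel))"
    and mY: "(\<lambda>x. \<lambda>i\<in>I. Y i x) \<in> measurable N (PiM I (\<lambda>_. borel))"
    using X Y by (auto intro!: measurable_restrict)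
  interpret DM: prob_space "distr M (PiM I (\<lambda>_. borel)) (\<lambda>x. \<lambda>i\<in>I. X i x)"
    by (rule M.prob_space_distr[OF mX])
  interpret DN: prob_space "distr N (PiM I (\<lambda>_. borel)) (\<lambda>x. \<lambda>i\<in>I. Y i x)"
    by (rule N.prob_space_distr[OF mY])
  have box: "measure (distr L (PiM I (\<lambda>_. borel)) (\<lambda>x. \<lambda>i\<in>I. Z i x)) (Pi\<^sub>E I A)
      = (\<integral>x. (\<Prod>i\<in>I. indicator (A i) (Z i x)) \<partial>L)"
    if mZ: "(\<lambda>x. \<lambda>i\<in>I. Z i x) \<in> measurable L (PiM I (\<lambda>_. borel))"
      and A: "\<And>i. i \<in> I \<Longrightarrow> A i \<in> sets borel"
    for L :: "'c measure" and Z :: "'i \<Rightarrow> 'c \<Rightarrow> real" and A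
  proof -
    have "Pi\<^sub>E I A \<in> sets (PiM I (\<lambda>_. borel))"
      using I A by (intro sets_PiM_I_finite) auto
    then have "measure (distr L (PiM I (\<lambda>_. borel)) (\<lambda>x. \<lambda>i\<in>I. Z i x)) (Pi\<^sub>E I A)
        = (\<integral>x. indicator (Pi\<^sub>E I A) (\<lambda>i\<in>I. Z i x) \<partial>L)"
      using integral_distr[OF mZ, of "indicator (Pi\<^sub>E I A) :: _ \<Rightarrow> real"] by simp
    also have "\<dots> = (\<integral>x. (\<Prod>i\<in>I. indicator (A i) (Z i x)) \<partial>L)"
      using I by (intro Bochner_Integration.integral_cong refl)
        (auto simp: indicator_def prod_zero_iff PiE_iff)
    finally show ?thesis .
  qed
  show ?thesis
  proof (rule measure_eqI_PiM_finite[OF I])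
    fix A :: "'i \<Rightarrow> real set" assume A: "\<And>i. i \<in> I \<Longrightarrow> A i \<in> sets borel"
    \<comment> \<open>For \<open>K = I\<close> no character is left; the complex identity is one
      between real integrals.\<close>
    have "complex_of_real (\<integral>x. (\<Prod>i\<in>I. indicator (A i) (X i x)) \<partial>M)
        = complex_of_real (\<integral>x. (\<Prod>i\<in>I. indicator (A i) (Y i x)) \<partial>N)"
      using mixed[OF I subset_refl A] unfolding integral_complex_of_real[symmetric] by simp
    then show "emeasure (distr M (PiM I (\<lambda>_. borel)) (\<lambda>x. \<lambda>i\<in>I. X i x)) (Pi\<^sub>E I A)
        = emeasure (distr N (PiM I (\<lambda>_. borel)) (\<lambda>x. \<lambda>i\<in>I. Y i x)) (Pi\<^sub>E I A)"
      using box[OF mX, of A] box[OF mY, of A] A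
      by (simp add: DM.emeasure_eq_measure DN.emeasure_eq_measure)
  next
    \<comment> \<open>The constant sequence with value the whole space exhausts it by sets of finite
      measure.\<close>
    show "range (\<lambda>_::nat. Pi\<^sub>E I (\<lambda>_. UNIV)) \<subseteq> prod_algebra I (\<lambda>_. borel :: real measure)"
      using I by (auto intro!: prod_algebraI_finite)
  qed (auto simp: space_PiM)
qed

subsection \<open>Noise paths\<close>

lemma measurable_vec_index:
  assumes "(\<lambda>\<omega>. vec_coords d (X \<omega>)) \<in> measurable M (PiM {..<d} (\<lambda>_. borel))" and "i < d"
  shows "(\<lambda>\<omega>. vec_index (X \<omega>) i) \<in> borel_measurable M"
  using measurable_compose[OF assms(1) measurable_component_singleton[of i]] assms(2)
  by (simp add: vec_coords_def)

text \<open>The joint characteristic function at \<open>t\<close> is an integral against the law of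
  the projection along \<open>t\<close>, which \<open>gaussian_vec\<close> prescribes; so its value
  depends on the parameters alone.\<close>

lemma gaussian_vec_iexp:
  assumes X: "(\<lambda>\<omega>. vec_coords d (X \<omega>)) \<in> measurable M (PiM {..<d} (\<lambda>_. borel))"
    and dim: "\<And>\<omega>. \<omega> \<in> space M \<Longrightarrow> X \<omega> \<in> carrier_vec d"
    and gauss: "gaussian_vec M d X m S"
  shows "(CLINT \<omega>|M. iexp (\<Sum>i<d. t i * vec_index (X \<omega>) i)) =
    (CLINT y|gauss_measure (scalar_prod (Matrix.vec d t) m)
      (scalar_prod (Matrix.vec d t) (S *\<^sub>v Matrix.vec d t)). iexp y)"
proof -
  let ?a = "Matrix.vec d t"
  \<comment> \<open>The dimension of \<open>X \<omega>\<close> is known on \<open>space M\<close>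
    only; elsewhere the scalar product may range over other indices.\<close>
  have eq: "scalar_prod ?a (X \<omega>) = (\<Sum>i<d. t i * vec_index (X \<omega>) i)" if "\<omega> \<in> space M" for \<omega>
    using dim[OF that] by (auto simp: scalar_prod_def atLeast0LessThan)
  have "(\<lambda>\<omega>. \<Sum>i<d. t i * vec_index (X \<omega>) i) \<in> borel_measurable M"
    using measurable_vec_index[OF X] by (auto intro!: borel_measurable_sum borel_measurable_times)
  then have meas: "(\<lambda>\<omega>. scalar_prod ?a (X \<omega>)) \<in> borel_measurable M"
    by (rule measurable_cong[THEN iffD2, rotated]) (rule eq)
  have "(CLINT \<omega>|M. iexp (\<Sum>i<d. t i * vec_index (X \<omega>) i)) = (CLINT \<omega>|M. iexp (scalar_prod ?a (X \<omega>)))"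
    by (intro Bochner_Integration.integral_cong) (simp_all add: eq)
  also have "\<dots> = (CLINT y|distr M borel (\<lambda>\<omega>. scalar_prod ?a (X \<omega>)). iexp y)"
    by (rule integral_distr[symmetric, OF meas]) simp
  finally show ?thesis
    using gauss by (simp add: gaussian_vec_def)
qed

text \<open>Both joint characteristic functions reduce to the same expression in \<open>m\<close>
  and \<open>S\<close>, whatever the underlying probability spaces.\<close>

lemma gaussian_vec_law_unique:
  assumes M: "prob_space M" and N: "prob_space N"
    and X: "(\<lambda>\<omega>. vec_coords d (X \<omega>)) \<in> measurable M (PiM {..<d} (\<lambda>_. borel))"
    and Y: "(\<lambda>\<omega>. vec_coords d (Y \<omega>)) \<in> measurable N (PiM {..<d} (\<lambda>_. borel))"
    and dim: "\<And>\<omega>. \<omega> \<in> space M \<Longrightarrow> X \<omega> \<in> carrier_vec d" "\<And>\<omega>. \<omega> \<in> space N \<Longrightarrow> Y \<omega> \<in> carrier_vec d"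
    and gauss: "gaussian_vec M d X m S" "gaussian_vec N d Y m S"
  shows "distr M (PiM {..<d} (\<lambda>_. borel)) (\<lambda>\<omega>. vec_coords d (X \<omega>))
    = distr N (PiM {..<d} (\<lambda>_. borel)) (\<lambda>\<omega>. vec_coords d (Y \<omega>))"
  unfolding vec_coords_def
  by (rule distr_PiM_eqI_char[OF M N])
    (use measurable_vec_index[OF X] measurable_vec_index[OF Y] in
      \<open>simp_all only: gaussian_vec_iexp[OF X dim(1) gauss(1)] gaussian_vec_iexp[OF Y dim(2) gauss(2)]
        lessThan_iff finite_lessThan\<close>)

section \<open>The joint law of a whole noise path\<close>

definition noise_space :: "nat \<Rightarrow> nat \<Rightarrow> (nat + nat \<Rightarrow> nat \<Rightarrow> real) measure" where
  "noise_space l p =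
     PiM UNIV (case_sum (\<lambda>_. PiM {..<l} (\<lambda>_. borel)) (\<lambda>_. PiM {..<p} (\<lambda>_. borel)))"

text \<open>\<open>Inl t\<close> indexes the process noise and \<open>Inr t\<close> the measurement
  noise, as in the independence clause of \<open>noise_model\<close>. Vectors enter as coordinate
  functions, on which the product sigma-algebras live.\<close>

definition noise_path :: "nat \<Rightarrow> nat \<Rightarrow> (nat \<Rightarrow> 'a \<Rightarrow> real Matrix.vec) \<Rightarrow> (nat \<Rightarrow> 'a \<Rightarrow> real Matrix.vec)
    \<Rightarrow> 'a \<Rightarrow> nat + nat \<Rightarrow> nat \<Rightarrow> real" where
  "noise_path l p w \<nu> \<omega> = case_sum (\<lambda>t. vec_coords l (w t \<omega>)) (\<lambda>t. vec_coords p (\<nu> t \<omega>))"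

text \<open>Mutual independence of the family means that its joint law is the product of the
  marginals; this turns \<open>noise_model\<close> into an explicit product measure on path
  space.\<close>

lemma noise_path_law:
  assumes noise: "noise_model M l p \<mu> \<Psi> w \<nu>"
  shows noise_path_measurable: "noise_path l p w \<nu> \<in> measurable M (noise_space l p)"
    and noise_path_components:
      "(\<lambda>\<omega>. vec_coords l (w t \<omega>)) \<in> measurable M (PiM {..<l} (\<lambda>_. borel))"
      "(\<lambda>\<omega>. vec_coords p (\<nu> t \<omega>)) \<in> measurable M (PiM {..<p} (\<lambda>_. borel))"
    and distr_noise_path: "distr M (noise_space l p) (noise_path l p w \<nu>) =
      PiM UNIV (case_sum (\<lambda>t. distr M (PiM {..<l} (\<lambda>_. borel)) (\<lambda>\<omega>. vec_coords l (w t \<omega>)))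
        (\<lambda>t. distr M (PiM {..<p} (\<lambda>_. borel)) (\<lambda>\<omega>. vec_coords p (\<nu> t \<omega>))))"
proof -
  interpret prob_space M
    using noise by (simp add: noise_model_def)
  let ?S = "case_sum (\<lambda>_::nat. PiM {..<l} (\<lambda>_. borel)) (\<lambda>_::nat. PiM {..<p} (\<lambda>_. borel))
    :: nat + nat \<Rightarrow> (nat \<Rightarrow> real) measure"
  let ?Z = "\<lambda>k \<omega>. noise_path l p w \<nu> \<omega> k"
  have "indep_vars ?S ?Z UNIV"
    using noise unfolding noise_model_def noise_path_def by auto
  moreover from this have rv: "random_variable (?S k) (?Z k)" for k
    unfolding indep_vars_def by auto
  ultimately have law: "distr M (PiM UNIV ?S) (\<lambda>\<omega>. \<lambda>k\<in>UNIV. ?Z k \<omega>) = PiM UNIV (\<lambda>k. distr M (?S k) (?Z k))"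
    by (subst (asm) indep_vars_iff_distr_eq_PiM) auto
  show "noise_path l p w \<nu> \<in> measurable M (noise_space l p)"
    using measurable_restrict[of UNIV ?Z M ?S, OF rv] by (simp add: noise_space_def restrict_def)
  show "(\<lambda>\<omega>. vec_coords l (w t \<omega>)) \<in> measurable M (PiM {..<l} (\<lambda>_. borel))"
    "(\<lambda>\<omega>. vec_coords p (\<nu> t \<omega>)) \<in> measurable M (PiM {..<p} (\<lambda>_. borel))"
    using rv[of "Inl t"] rv[of "Inr t"] by (simp_all add: noise_path_def)
  have "(\<lambda>k. distr M (?S k) (?Z k)) =
      case_sum (\<lambda>t. distr M (PiM {..<l} (\<lambda>_. borel)) (\<lambda>\<omega>. vec_coords l (w t \<omega>)))
        (\<lambda>t. distr M (PiM {..<p} (\<lambda>_. borel)) (\<lambda>\<omega>. vec_coords p (\<nu> t \<omega>)))"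
    by (auto simp: fun_eq_iff noise_path_def split: sum.split)
  with law show "distr M (noise_space l p) (noise_path l p w \<nu>) =
      PiM UNIV (case_sum (\<lambda>t. distr M (PiM {..<l} (\<lambda>_. borel)) (\<lambda>\<omega>. vec_coords l (w t \<omega>)))
        (\<lambda>t. distr M (PiM {..<p} (\<lambda>_. borel)) (\<lambda>\<omega>. vec_coords p (\<nu> t \<omega>))))"
    by (simp add: noise_space_def restrict_def)
qed

text \<open>Both path laws are products, so it suffices that the factors agree, and each factor is
  fixed by its Gaussian parameters.\<close>

lemma noise_path_law_unique:
  assumes noise: "noise_model M l p \<mu> \<Psi> w \<nu>" and noise': "noise_model M' l p \<mu> \<Psi> w' \<nu>'"
  shows "distr M (noise_space l p) (noise_path l p w \<nu>) = distr M' (noise_space l p) (noise_path l p w' \<nu>')"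
proof -
  have "distr M (PiM {..<l} (\<lambda>_. borel)) (\<lambda>\<omega>. vec_coords l (w t \<omega>))
      = distr M' (PiM {..<l} (\<lambda>_. borel)) (\<lambda>\<omega>. vec_coords l (w' t \<omega>))" for t
    by (rule gaussian_vec_law_unique[OF _ _ noise_path_components(1)[OF noise] noise_path_components(1)[OF noise']])
      (use noise noise' in \<open>auto simp: noise_model_def\<close>)
  moreover have "distr M (PiM {..<p} (\<lambda>_. borel)) (\<lambda>\<omega>. vec_coords p (\<nu> t \<omega>))
      = distr M' (PiM {..<p} (\<lambda>_. borel)) (\<lambda>\<omega>. vec_coords p (\<nu>' t \<omega>))" for t
    by (rule gaussian_vec_law_unique[OF _ _ noise_path_components(2)[OF noise] noise_path_components(2)[OF noise']])
      (use noise noise' in \<open>auto simp: noise_model_def\<close>)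
  ultimately show ?thesis
    by (simp add: distr_noise_path[OF noise] distr_noise_path[OF noise'])
qed

section \<open>Outputs as functionals of the noise path\<close>

definition path_process_noise :: "nat \<Rightarrow> nat \<Rightarrow> (nat + nat \<Rightarrow> nat \<Rightarrow> real) \<Rightarrow> real Matrix.vec" where
  "path_process_noise l t z = Matrix.vec l (z (Inl t))"

definition path_output_noise :: "nat \<Rightarrow> nat \<Rightarrow> (nat + nat \<Rightarrow> nat \<Rightarrow> real) \<Rightarrow> real Matrix.vec" where
  "path_output_noise p t z = Matrix.vec p (z (Inr t))"

text \<open>\<open>path_process_noise\<close> and \<open>path_output_noise\<close> read off the
  vectors stored in a path, so the output depends on \<omega> only through the noise path.\<close>

lemma lti_output_noise_path:
  assumes "\<And>t. w t \<omega> \<in> carrier_vec l" "\<And>t. \<nu> t \<omega> \<in> carrier_vec p"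
  shows "lti_output C A B G x u w \<nu> t \<omega> =
    lti_output C A B G x u (path_process_noise l) (path_output_noise p) t (noise_path l p w \<nu> \<omega>)"
proof -
  have "path_process_noise l s (noise_path l p w \<nu> \<omega>) = w s \<omega>" "path_output_noise p s (noise_path l p w \<nu> \<omega>) = \<nu> s \<omega>" for s
    using assms[of s] by (auto simp: path_process_noise_def path_output_noise_def noise_path_def vec_coords_def)
  moreover from this have "lti_state A B G x u (path_process_noise l) t (noise_path l p w \<nu> \<omega>) = lti_state A B G x u w t \<omega>"
    by (induction t) simp_all
  ultimately show ?thesis
    by (simp add: lti_output_def)
qed

text \<open>A vector sum takes the dimension of its second summand. In a successor state this is
  \<open>G *\<^sub>v w t \<omega>\<close>, with as many entries as \<open>G\<close> has
  rows.\<close>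

lemma lti_state_carrier:
  assumes "G \<in> carrier_mat n l" "x \<in> carrier_vec n"
  shows "lti_state A B G x u w t \<omega> \<in> carrier_vec n"
  using assms by (cases t) (auto intro!: carrier_vecI)

lemma borel_measurable_mult_mat_vec:
  fixes D :: "real mat"
  assumes D: "D \<in> carrier_mat a b" and i: "i < a"
    and v: "\<And>z. v z \<in> carrier_vec b" "\<And>j. j < b \<Longrightarrow> (\<lambda>z. vec_index (v z) j) \<in> borel_measurable N"
  shows "(\<lambda>z. vec_index (D *\<^sub>v v z) i) \<in> borel_measurable N"
proof -
  have "vec_index (D *\<^sub>v v z) i = (\<Sum>j<b. D $$ (i, j) * vec_index (v z) j)" for z
    using D i v(1)[of z] by (auto simp: scalar_prod_def atLeast0LessThan)
  then show ?thesis
    using v(2) by (auto intro!: borel_measurable_sum borel_measurable_times)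
qed

lemma path_measurable:
  "i < l \<Longrightarrow> (\<lambda>z. vec_index (path_process_noise l t z) i) \<in> borel_measurable (noise_space l p)"
  "i < p \<Longrightarrow> (\<lambda>z. vec_index (path_output_noise p t z) i) \<in> borel_measurable (noise_space l p)"
proof -
  let ?S = "case_sum (\<lambda>_::nat. PiM {..<l} (\<lambda>_. borel)) (\<lambda>_::nat. PiM {..<p} (\<lambda>_. borel))
    :: nat + nat \<Rightarrow> (nat \<Rightarrow> real) measure"
  have c: "(\<lambda>z. z k) \<in> measurable (noise_space l p) (?S k)" for k
    unfolding noise_space_def by (rule measurable_component_singleton) simp
  show "(\<lambda>z. vec_index (path_process_noise l t z) i) \<in> borel_measurable (noise_space l p)" if "i < l"
    using measurable_compose[OF c[of "Inl t", simplified] measurable_component_singleton[of i]] that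
    by (simp add: path_process_noise_def)
  show "(\<lambda>z. vec_index (path_output_noise p t z) i) \<in> borel_measurable (noise_space l p)" if "i < p"
    using measurable_compose[OF c[of "Inr t", simplified] measurable_component_singleton[of i]] that
    by (simp add: path_output_noise_def)
qed

text \<open>By induction on time each state coordinate is an affine function of finitely many noise
  coordinates. Measurability is what allows the output law to be computed as an image of the path
  law.\<close>

lemma lti_output_measurable:
  assumes A: "A \<in> carrier_mat n n" and B: "B \<in> carrier_mat n m"
    and G: "G \<in> carrier_mat n l" and C: "C \<in> carrier_mat p n" and x: "x \<in> carrier_vec n"
  shows "(\<lambda>z. vec_coords p (lti_output C A B G x u (path_process_noise l) (path_output_noise p) t z))
    \<in> measurable (noise_space l p) (PiM {..<p} (\<lambda>_. borel))"
proof -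
  note car = lti_state_carrier[OF G x]
  have [simp]: "dim_vec (path_process_noise l s z) = l" "dim_vec (path_output_noise p s z) = p" for s z
    by (simp_all add: path_process_noise_def path_output_noise_def)
  then have [simp]: "path_process_noise l s z \<in> carrier_vec l" for s z
    by (metis carrier_vec_dim_vec)
  have state: "(\<lambda>z. vec_index (lti_state A B G x u (path_process_noise l) t z) i) \<in> borel_measurable (noise_space l p)"
    if "i < n" for i t
    using that
  proof (induction t arbitrary: i)
    case (Suc t)
    have "(\<lambda>z. vec_index (A *\<^sub>v lti_state A B G x u (path_process_noise l) t z) i) \<in> borel_measurable (noise_space l p)"
      by (rule borel_measurable_mult_mat_vec[OF A Suc.prems car Suc.IH])
    moreover have "(\<lambda>z. vec_index (G *\<^sub>v path_process_noise l t z) i) \<in> borel_measurable (noise_space l p)"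
      by (rule borel_measurable_mult_mat_vec[OF G Suc.prems]) (auto intro: path_measurable)
    ultimately show ?case
      using Suc.prems A B G by simp
  qed simp
  have "(\<lambda>z. vec_index (C *\<^sub>v lti_state A B G x u (path_process_noise l) t z) i) \<in> borel_measurable (noise_space l p)"
    if "i < p" for i
    by (rule borel_measurable_mult_mat_vec[OF C that car state])
  then show ?thesis
    using C unfolding vec_coords_def
    by (intro measurable_restrict) (simp add: lti_output_def path_measurable borel_measurable_add)
qed

text \<open>Each output law is the image of a noise path law under one and the same functional, and
  the two path laws coincide. Pathwise equality on the common path space thus replaces a coupling of
  the two probability spaces.\<close>

lemma stoch_equivI:
  assumes noise: "noise_model M l p \<mu> \<Psi> w \<nu>" and noise': "noise_model M' l p \<mu> \<Psi> w' \<nu>'"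
    and dims: "A \<in> carrier_mat n n" "B \<in> carrier_mat n m" "G \<in> carrier_mat n l" "C \<in> carrier_mat p n"
      "x \<in> carrier_vec n"
    and same: "\<And>t z. lti_output C' A' B' G' x' u (path_process_noise l) (path_output_noise p) t z =
      lti_output C A B G x u (path_process_noise l) (path_output_noise p) t z"
  shows "stoch_equiv p M' (lti_output C' A' B' G' x' u w' \<nu>') M (lti_output C A B G x u w \<nu>)"
  unfolding stoch_equiv_def
proof (intro allI impI)
  fix S :: "nat set"
  let ?P = "PiM S (\<lambda>_. PiM {..<p} (\<lambda>_. borel)) :: (nat \<Rightarrow> nat \<Rightarrow> real) measure"
  let ?Y = "\<lambda>z. \<lambda>t\<in>S. vec_coords p (lti_output C A B G x u (path_process_noise l) (path_output_noise p) t z)"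
  have meas: "?Y \<in> measurable (noise_space l p) ?P"
    by (intro measurable_restrict lti_output_measurable[OF dims])
  \<comment> \<open>Stated for an arbitrary system and noise realisation so that it serves both
    sides: with \<open>refl\<close> for the unprimed system, with \<open>same\<close> for the primed
    one.\<close>
  have law: "distr L ?P (\<lambda>\<omega>. \<lambda>t\<in>S. vec_coords p (lti_output D E F H y u v \<eta> t \<omega>))
      = distr (distr L (noise_space l p) (noise_path l p v \<eta>)) ?P ?Y"
    if L: "noise_model L l p \<mu> \<Psi> v \<eta>"
      and eq: "\<And>t z. lti_output D E F H y u (path_process_noise l) (path_output_noise p) t z =
        lti_output C A B G x u (path_process_noise l) (path_output_noise p) t z"
    for L :: "'c measure" and v \<eta> D E F H y
  proof -
    have "lti_output D E F H y u v \<eta> t \<omega> =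
        lti_output C A B G x u (path_process_noise l) (path_output_noise p) t (noise_path l p v \<eta> \<omega>)"
      if "\<omega> \<in> space L" for t \<omega>
      using L that by (subst lti_output_noise_path[where l=l and p=p]) (auto simp: noise_model_def eq)
    then show ?thesis
      by (subst distr_distr[OF meas noise_path_measurable[OF L]])
        (intro distr_cong, auto simp: fun_eq_iff)
  qed
  show "distr M' ?P (\<lambda>\<omega>. \<lambda>t\<in>S. vec_coords p (lti_output C' A' B' G' x' u w' \<nu>' t \<omega>)) =
      distr M ?P (\<lambda>\<omega>. \<lambda>t\<in>S. vec_coords p (lti_output C A B G x u w \<nu> t \<omega>))"
    unfolding law[OF noise refl] law[OF noise' same] noise_path_law_unique[OF noise noise'] ..
qed
subsection \<open>The quotient map\<close>

text \<open>Lower blocks with zero rows make \<open>four_block_mat\<close> the horizontal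
  concatenation of \<open>T1\<close> and \<open>T2\<close>.\<close>

lemma four_block_mat_append_cols_mult_vec:
  assumes "T1 \<in> carrier_mat n a" "T2 \<in> carrier_mat n b" "v \<in> carrier_vec a" "w \<in> carrier_vec b"
  shows "four_block_mat T1 T2 (0\<^sub>m 0 a) (0\<^sub>m 0 b) *\<^sub>v (v @\<^sub>v w) = T1 *\<^sub>v v + T2 *\<^sub>v (w :: real Matrix.vec)"
  using assms by (subst four_block_mat_mult_vec[of _ n a _ b _ 0]) auto

lemma upper_rows_mult_vec:
  assumes "D \<in> carrier_mat n k" "a \<le> n" "v \<in> carrier_vec k"
  shows "Matrix.mat a k (\<lambda>ij. D $$ ij) *\<^sub>v v = vec_first (D *\<^sub>v v) a"
  using assms by (auto simp: vec_first_def scalar_prod_def)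

text \<open>Padding with zeros hides the last \<open>b\<close> columns, and \<open>vec_first\<close>
  discards the lower rows.\<close>

lemma upper_left_block_mult_vec:
  assumes "D \<in> carrier_mat n (a + b)" "a \<le> n" "v \<in> carrier_vec a"
  shows "Matrix.mat a a (\<lambda>ij. D $$ ij) *\<^sub>v v = vec_first (D *\<^sub>v (v @\<^sub>v 0\<^sub>v b)) a"
proof -
  have "(\<Sum>j = 0..<a. D $$ (i, j) * vec_index v j) =
      (\<Sum>j = 0..<a + b. D $$ (i, j) * vec_index (v @\<^sub>v 0\<^sub>v b) j)" if "i < a" for i
    using assms by (intro sum.mono_neutral_cong_left) auto
  then show ?thesis
    using assms by (auto simp: vec_first_def scalar_prod_def)
qed

lemma vec_first_append:
  "v \<in> carrier_vec a \<Longrightarrow> vec_first (v @\<^sub>v w) a = v"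
  by (auto simp: vec_first_def)

lemma vec_first_add:
  "v \<in> carrier_vec n \<Longrightarrow> w \<in> carrier_vec n \<Longrightarrow> a \<le> n \<Longrightarrow> vec_first (v + w) a = vec_first v a + vec_first w a"
  by (auto simp: vec_first_def)

lemma vec_first_smult:
  "v \<in> carrier_vec n \<Longrightarrow> a \<le> n \<Longrightarrow> vec_first (k \<cdot>\<^sub>v v) a = k \<cdot>\<^sub>v vec_first v a"
  by (auto simp: vec_first_def)

text \<open>Under a common input and noise path, \<open>\<pi>\<close> intertwines the two
  recursions, so by induction it carries state to state at every time.\<close>

lemma lti_output_semiconjugate:
  assumes G: "G \<in> carrier_mat n l" and x: "x \<in> carrier_vec n"
    and w: "\<And>t. w t \<omega> \<in> carrier_vec l" and u: "\<And>t. u t \<in> carrier_vec m"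
    and step: "\<And>x u w. x \<in> carrier_vec n \<Longrightarrow> u \<in> carrier_vec m \<Longrightarrow> w \<in> carrier_vec l \<Longrightarrow>
      \<pi> (A *\<^sub>v x + B *\<^sub>v u + G *\<^sub>v w) = A' *\<^sub>v \<pi> x + B' *\<^sub>v u + G' *\<^sub>v w"
    and out: "\<And>x. x \<in> carrier_vec n \<Longrightarrow> C' *\<^sub>v \<pi> x = C *\<^sub>v x"
  shows "lti_output C' A' B' G' (\<pi> x) u w \<nu> t \<omega> = lti_output C A B G x u w \<nu> t \<omega>"
proof -
  have "lti_state A' B' G' (\<pi> x) u w t \<omega> = \<pi> (lti_state A B G x u w t \<omega>)"
    by (induction t) (simp_all add: step u w lti_state_carrier[OF G x])
  then show ?thesis
    by (simp add: lti_output_def out lti_state_carrier[OF G x])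
qed

theorem theorem3:
  fixes n m l p r ne :: nat
    and A B G C R T T1 T2 Ti :: "real mat"
    and \<mu> :: "real Matrix.vec" and \<Psi> :: "real mat"
    and M :: "'a measure" and w \<nu> :: "nat \<Rightarrow> 'a \<Rightarrow> real Matrix.vec"
    and M' :: "'b measure" and w' \<nu>' :: "nat \<Rightarrow> 'b \<Rightarrow> real Matrix.vec"
  assumes A: "A \<in> carrier_mat n n" and B: "B \<in> carrier_mat n m"
    and G: "G \<in> carrier_mat n l" and C: "C \<in> carrier_mat p n"
    and mu: "\<mu> \<in> carrier_vec l"
    and Psi: "\<Psi> \<in> carrier_mat p p" "transpose_mat \<Psi> = \<Psi>"
      "\<forall>a\<in>carrier_vec p. 0 \<le> scalar_prod a (\<Psi> *\<^sub>v a)"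
    and R: "R \<in> carrier_mat r n" and rank: "vec_space.rank r R = ne"
    and inv_ker: "\<forall>v\<in>mat_kernel R. A *\<^sub>v v \<in> mat_kernel R"
    and ker_C: "mat_kernel R \<subseteq> mat_kernel C"
    and T1: "T1 \<in> carrier_mat n ne" and T2: "T2 \<in> carrier_mat n (n - ne)"
    and T: "T = four_block_mat T1 T2 (0\<^sub>m 0 ne) (0\<^sub>m 0 (n - ne))"
    and Ti: "Ti \<in> carrier_mat n n" "T * Ti = 1\<^sub>m n" "Ti * T = 1\<^sub>m n"
    and im_T2: "{T2 *\<^sub>v v | v. v \<in> carrier_vec (n - ne)} = mat_kernel R"
    and noise: "noise_model M l p \<mu> \<Psi> w \<nu>"
    and noise': "noise_model M' l p \<mu> \<Psi> w' \<nu>'"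
  shows "ext_equiv m p
           ne (Matrix.mat ne ne (\<lambda>ij. (Ti * A * T) $$ ij)) (Matrix.mat ne m (\<lambda>ij. (Ti * B) $$ ij))
              (Matrix.mat ne l (\<lambda>ij. (Ti * G) $$ ij)) (C * T1) M' w' \<nu>'
           n A B G C M w \<nu>"
proof -
  let ?\<pi> = "\<lambda>x. vec_first (Ti *\<^sub>v x) ne"
  let ?A = "Matrix.mat ne ne (\<lambda>ij. (Ti * A * T) $$ ij)"
  let ?B = "Matrix.mat ne m (\<lambda>ij. (Ti * B) $$ ij)"
  let ?G = "Matrix.mat ne l (\<lambda>ij. (Ti * G) $$ ij)"
  \<comment> \<open>Natural subtraction truncates, so the column count
    \<open>ne + (n - ne) = n\<close> forces \<open>ne \<le> n\<close>.\<close>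
  have "dim_col (Ti * T) = ne + (n - ne)"
    using T1 T2 T by simp
  with Ti(3) have ne: "ne \<le> n"
    by simp
  have Tc: "T \<in> carrier_mat n n"
    using T T1 T2 ne by auto
  have T_append: "T *\<^sub>v (a @\<^sub>v b) = T1 *\<^sub>v a + T2 *\<^sub>v b"
    if "a \<in> carrier_vec ne" "b \<in> carrier_vec (n - ne)" for a b
    unfolding T using T1 T2 that by (rule four_block_mat_append_cols_mult_vec)
  have TiT: "Ti *\<^sub>v (T *\<^sub>v v) = v" and TTi: "T *\<^sub>v (Ti *\<^sub>v v) = v" if "v \<in> carrier_vec n" for v
    using that Ti Tc by (simp_all flip: assoc_mult_mat_vec)
  have append_carrier: "a @\<^sub>v b \<in> carrier_vec n"
    if "a \<in> carrier_vec ne" "b \<in> carrier_vec (n - ne)" for a b :: "real Matrix.vec"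
    using that ne by (auto intro!: carrier_vecI)
  \<comment> \<open>Split \<open>T *\<^sub>v (Ti *\<^sub>v x) = x\<close> along the column blocks of
    \<open>T\<close>; the second part lies in the image of \<open>T2\<close>, which is the kernel of
    \<open>R\<close>.\<close>
  have decomp: "\<exists>k\<in>mat_kernel R. x = T1 *\<^sub>v ?\<pi> x + k" if x: "x \<in> carrier_vec n" for x
  proof
    let ?b = "vec_last (Ti *\<^sub>v x) (n - ne)"
    have "?\<pi> x @\<^sub>v ?b = Ti *\<^sub>v x"
      using Ti(1) ne x by (intro vec_first_last_append) (auto intro!: mult_mat_vec_carrier)
    with T_append[of "?\<pi> x" ?b] TTi[OF x] show "x = T1 *\<^sub>v ?\<pi> x + T2 *\<^sub>v ?b"
      by simp
    show "T2 *\<^sub>v ?b \<in> mat_kernel R"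
      unfolding im_T2[symmetric] using vec_last_carrier by blast
  qed
  have ker_carrier: "k \<in> carrier_vec n" if "k \<in> mat_kernel R" for k
    using that R by (auto simp: mat_kernel_def)
  have \<pi>_add: "?\<pi> (v + v') = ?\<pi> v + ?\<pi> v'" if "v \<in> carrier_vec n" "v' \<in> carrier_vec n" for v v'
    using that Ti(1) ne
    by (simp add: mult_add_distrib_mat_vec[of _ n n]) (rule vec_first_add[of _ n], auto intro: mult_mat_vec_carrier)
  have \<pi>_smult: "?\<pi> (c \<cdot>\<^sub>v v) = c \<cdot>\<^sub>v ?\<pi> v" if "v \<in> carrier_vec n" for c v
    using that Ti(1) ne
    by (simp add: mult_mat_vec[of _ n n]) (rule vec_first_smult[of _ n], auto intro: mult_mat_vec_carrier)
  \<comment> \<open>In the basis of columns of \<open>T\<close>, the vector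
    \<open>T1 *\<^sub>v a\<close> has coordinates \<open>a\<close> followed by zeros, so
    \<open>T1\<close> is a section of the quotient map.\<close>
  have T1_eq: "T1 *\<^sub>v a = T *\<^sub>v (a @\<^sub>v 0\<^sub>v (n - ne))" if "a \<in> carrier_vec ne" for a
    using T_append[OF that, of "0\<^sub>v (n - ne)"] T1 T2 that by auto
  have \<pi>_T1: "?\<pi> (T1 *\<^sub>v a) = a" if "a \<in> carrier_vec ne" for a
    using that by (simp add: T1_eq TiT append_carrier vec_first_append)
  \<comment> \<open>Kernel vectors are images under \<open>T2\<close>, so their first
    \<open>ne\<close> coordinates in this basis vanish.\<close>
  have \<pi>_ker: "?\<pi> k = 0\<^sub>v ne" if k: "k \<in> mat_kernel R" for k
  proof -
    obtain v where v: "v \<in> carrier_vec (n - ne)" "k = T2 *\<^sub>v v"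
      using k unfolding im_T2[symmetric] by blast
    then have "k = T *\<^sub>v (0\<^sub>v ne @\<^sub>v v)"
      using T_append[of "0\<^sub>v ne" v] T1 T2 by auto
    then show ?thesis
      using v by (simp add: TiT append_carrier vec_first_append)
  qed
  \<comment> \<open>Replacing \<open>x\<close> by its representative
    \<open>T1 *\<^sub>v ?\<pi> x\<close> changes \<open>A *\<^sub>v x\<close> by a vector that
    invariance keeps in the kernel of \<open>R\<close> and \<open>?\<pi>\<close> annihilates. On the
    representative, \<open>Ti * A * T\<close> acts on a vector ending in zeros, which leaves the
    upper-left block.\<close>
  have \<pi>_A: "?\<pi> (A *\<^sub>v x) = ?A *\<^sub>v ?\<pi> x" if x: "x \<in> carrier_vec n" for x
  proof -
    obtain k where k: "k \<in> mat_kernel R" "x = T1 *\<^sub>v ?\<pi> x + k"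
      using decomp[OF x] by blast
    have T1\<pi>: "T1 *\<^sub>v ?\<pi> x \<in> carrier_vec n"
      using T1 by (auto intro!: mult_mat_vec_carrier)
    have "A *\<^sub>v x = A *\<^sub>v (T1 *\<^sub>v ?\<pi> x) + A *\<^sub>v k"
      using mult_add_distrib_mat_vec[OF A T1\<pi> ker_carrier[OF k(1)]] k(2) by simp
    moreover have "A *\<^sub>v k \<in> mat_kernel R"
      using inv_ker k(1) by blast
    ultimately have "?\<pi> (A *\<^sub>v x) = ?\<pi> (A *\<^sub>v (T1 *\<^sub>v ?\<pi> x))"
      using A T1\<pi> by (simp add: \<pi>_add \<pi>_ker ker_carrier mult_mat_vec_carrier[of A n n])
    also have "A *\<^sub>v (T1 *\<^sub>v ?\<pi> x) = A *\<^sub>v (T *\<^sub>v (?\<pi> x @\<^sub>v 0\<^sub>v (n - ne)))"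
      by (simp add: T1_eq)
    also have "Ti *\<^sub>v \<dots> = (Ti * A * T) *\<^sub>v (?\<pi> x @\<^sub>v 0\<^sub>v (n - ne))"
      using Ti(1) A Tc append_carrier[of "?\<pi> x" "0\<^sub>v (n - ne)"]
      by (simp add: assoc_mult_mat_vec[of _ n n _ n])
    also have "vec_first \<dots> ne = ?A *\<^sub>v ?\<pi> x"
      using Ti(1) A Tc ne by (intro upper_left_block_mult_vec[symmetric, of _ n]) auto
    finally show ?thesis .
  qed
  have \<pi>_B: "?\<pi> (B *\<^sub>v v) = ?B *\<^sub>v v" if "v \<in> carrier_vec m" for v
    using that Ti(1) B ne by (subst upper_rows_mult_vec[of _ n]) auto
  have \<pi>_G: "?\<pi> (G *\<^sub>v v) = ?G *\<^sub>v v" if "v \<in> carrier_vec l" for v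
    using that Ti(1) G ne by (subst upper_rows_mult_vec[of _ n]) auto
  have \<pi>_step: "?\<pi> (A *\<^sub>v x + B *\<^sub>v v + G *\<^sub>v w) = ?A *\<^sub>v ?\<pi> x + ?B *\<^sub>v v + ?G *\<^sub>v w"
    if "x \<in> carrier_vec n" "v \<in> carrier_vec m" "w \<in> carrier_vec l" for x v w
    using that A B G
    by (simp add: \<pi>_add \<pi>_A \<pi>_B \<pi>_G mult_mat_vec_carrier[of _ n n] mult_mat_vec_carrier[of _ n m]
        mult_mat_vec_carrier[of _ n l])
  \<comment> \<open>The same representative serves for the output because the kernel of
    \<open>R\<close> lies in that of \<open>C\<close>.\<close>
  have \<pi>_C: "(C * T1) *\<^sub>v ?\<pi> x = C *\<^sub>v x" if x: "x \<in> carrier_vec n" for x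
  proof -
    obtain k where k: "k \<in> mat_kernel R" "x = T1 *\<^sub>v ?\<pi> x + k"
      using decomp[OF x] by blast
    have "C *\<^sub>v k = 0\<^sub>v p"
      using k(1) ker_C C by (auto simp: mat_kernel_def)
    moreover have "T1 *\<^sub>v ?\<pi> x \<in> carrier_vec n"
      using T1 by (auto intro!: mult_mat_vec_carrier)
    moreover note mult_add_distrib_mat_vec[OF C this ker_carrier[OF k(1)]]
    ultimately have "C *\<^sub>v x = C *\<^sub>v (T1 *\<^sub>v ?\<pi> x)"
      using k(2) C by simp
    then show ?thesis
      using C T1 by simp
  qed
  \<comment> \<open>The graph of the quotient map, with the quotient state first to match the order
    of the systems.\<close>
  let ?Rel = "{(?\<pi> x, x) | x. x \<in> carrier_vec n}"
  have "total_subspace ne n ?Rel"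
    unfolding total_subspace_def
  proof (intro conjI ballI allI)
    have "?\<pi> (0\<^sub>v n) = 0\<^sub>v ne"
      using Ti(1) ne by (intro eq_vecI) (auto simp: vec_first_def)
    then show "(0\<^sub>v ne, 0\<^sub>v n) \<in> ?Rel"
      by force
    \<comment> \<open>The section \<open>T1\<close> supplies a full state above each quotient state;
      in the other direction totality is immediate for a graph.\<close>
    show "\<exists>y. (a, y) \<in> ?Rel" if "a \<in> carrier_vec ne" for a
      using \<pi>_T1[OF that] T1 that by (intro exI[of _ "T1 *\<^sub>v a"]) (force intro: mult_mat_vec_carrier)
  qed (auto simp: \<pi>_add \<pi>_smult)
  \<comment> \<open>Semiconjugacy is applied on path space, where both systems see the same noise;
    \<open>stoch_equivI\<close> transfers it to the separate realisations.\<close>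
  moreover have "stoch_equiv p M' (lti_output (C * T1) ?A ?B ?G (?\<pi> x) u w' \<nu>') M (lti_output C A B G x u w \<nu>)"
    if x: "x \<in> carrier_vec n" and u: "\<forall>t. u t \<in> carrier_vec m" for x u
    by (rule stoch_equivI[OF noise noise' A B G C x], rule lti_output_semiconjugate[OF G x _ _ \<pi>_step \<pi>_C])
      (use u in \<open>auto simp: path_process_noise_def\<close>)
  ultimately show ?thesis
    unfolding ext_equiv_def by (intro exI[of _ ?Rel]) auto
qed

end
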